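(* Let $(G,\sigma)$ be a connected connection graph, with $\sigma$ taking values in $\mathbb{O}(d)$, let $\alpha,\beta\in\ell(V;\mathbb{R}^d)$, let $\lambda>0$ and $\delta\ge0$ be fixed, and put $c=\alpha-\beta$. Then the relaxed-regularized Beckmann problem $$\mathcal{W}_1^{\sigma,\delta,\lambda}(\alpha,\beta)=\inf_{J\in\ell(E';\mathbb{R}^d)}\left\{\sum_{e\in E'}w(e)\|J(e)\|_2+\frac{\lambda}{2}\|J\|_2^2 : \|BJ-(\alpha-\beta)\|_\infty\le\delta\right\}$$ has Lagrangian dual given by $$\sup_{\phi\in\ell(V;\mathbb{R}^d)}\ \langle\phi,c\rangle-\delta\|\phi\|_1-\frac{1}{2\lambda}\sum_{e\in E'}\left(\|(B^\top\phi)(e)\|_2-w(e)\right)_+^2,$$ and strong duality holds, i.e. the primal infimum and the dual supremum are equal (in $[0,+\infty]$). Moreover, if $\phi^\ast$ solves the dual problem (attains the supremum), then the optimal primal variable $J^\ast$ (the minimizer of the primal problem) is given, for each $e\in E'$, by $$J^\ast(e)=\left(\frac{\|(B^\top\phi^\ast)(e)\|_2-w(e)}{\lambda}\right)_+\frac{(B^\top\phi^\ast)(e)}{\|(B^\top\phi^\ast)(e)\|_2},$$ where the right-hand side is understood to be $0$ when $(B^\top\phi^\ast)(e)=0$.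
   Context: $G=(V,E,w)$ is a finite, connected, weighted, undirected graph with $V=\{1,\dots,n\}$, $n\ge 2$, $E\subseteq\binom{V}{2}$, $|E|=m\ge1$, and symmetric weights $w_{ij}\ge 0$ with $w_{ij}>0$ iff $\{i,j\}\in E$ (written $i\sim j$). The index-oriented edge set is $E'=\{(i,j): i<j,\ i\sim j\}$, and $w(e)=w_{ij}$ for $e=(i,j)\in E'$. $\mathbb{O}(d)$ is the group of $d\times d$ real orthogonal matrices, $d\ge1$. A connection is a map $\sigma:E'\to\mathbb{O}(d)$, written $\sigma_{ij}=\sigma((i,j))$, extended by $\sigma_{ji}=\sigma_{ij}^{-1}=\sigma_{ij}^\top$; the pair $(G,\sigma)$ is a connection graph. $\ell(V;\mathbb{R}^d)$ and $\ell(E';\mathbb{R}^d)$ are the spaces of functions $V\to\mathbb{R}^d$ and $E'\to\mathbb{R}^d$, identified with column vectors in $\mathbb{R}^{nd}$ and $\mathbb{R}^{md}$, with the standard inner product $\langle f,g\rangle=f^\top g$; $\|\cdot\|_1,\|\cdot\|_2,\|\cdot\|_\infty$ are the usual $\ell_p$ norms of these column vectors (and $\|\cdot\|_2$ also denotes the Euclidean norm on $\mathbb{R}^d$). The connection incidence matrix $B\in\mathbb{R}^{nd\times md}$ is the block matrix with $d\times d$ blocks, for $i\in V$, $e\in E'$: $B_{ie}=I_d$ if $e=(i,\cdot)$, $B_{ie}=-\sigma_e^\top$ if $e=(\cdot,i)$, and $B_{ie}=0$ otherwise; thus $(B^\top f)((i,j))=f(i)-\sigma_{ij}f(j)$. For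 a real number $x$, $(x)_+=\max\{x,0\}$. The infimum over the empty set is $+\infty$. The Lagrangian dual is taken with the constraint written as the elementwise linear inequalities $BJ-c-\delta\mathbf{1}\le0$ and $-(BJ-c)-\delta\mathbf{1}\le0$ with multipliers $\xi_1,\xi_2\ge0$ in $\mathbb{R}^{nd}$, and is expressed in terms of the variable $\phi=\xi_2-\xi_1$. *)

theory Defs
  imports "HOL-Analysis.Analysis"
begin

text \<open>
  The vertex set $V = \{1,\dots,n\}$ is the whole of a finite linearly ordered type \<open>'n\<close>, so that
  $n$ is \<open>CARD('n)\<close>; the order is used only to orient the edges. Likewise $d$ is \<open>CARD('d)\<close>.
\<close>

definition oriented_edges :: "'n::{finite,linorder} set set \<Rightarrow> ('n \<times> 'n) set" where
  "oriented_edges E = {(i, j). i < j \<and> {i, j} \<in> E}"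

locale connection_graph =
  fixes E :: "'n::{finite,linorder} set set"
    and w :: "'n \<Rightarrow> 'n \<Rightarrow> real"
    and \<sigma> :: "'n \<times> 'n \<Rightarrow> real^'d^'d"
  assumes two_vertices: "CARD('n) \<ge> 2"
    and edges_pairs: "\<And>e. e \<in> E \<Longrightarrow> card e = 2"
    and edges_nonempty: "card E \<ge> 1"
    and weight_sym: "\<And>i j. w i j = w j i"
    and weight_nonneg: "\<And>i j. w i j \<ge> 0"
    and weight_pos_iff: "\<And>i j. w i j > 0 \<longleftrightarrow> {i, j} \<in> E"
    and connected_graph: "\<And>i j. (i, j) \<in> {(a, b). {a, b} \<in> E}\<^sup>*"
    and orthogonal_connection: "\<And>e. e \<in> oriented_edges E \<Longrightarrow> orthogonal_matrix (\<sigma> e)"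

text \<open>
  The set $E'$ of oriented edges is not a type, so $\ell(E';\mathbb{R}^d)$ is represented by the
  vectors indexed by all pairs of vertices that vanish off $E'$. Inner product and norm of such
  vectors are those of the corresponding column vectors in $\mathbb{R}^{md}$.
\<close>

type_synonym ('d, 'n) vertex_fun = "real^'d^'n"
type_synonym ('d, 'n) edge_fun = "real^'d^('n \<times> 'n)"

definition edge_space :: "'n::{finite,linorder} set set \<Rightarrow> ('d::finite, 'n) edge_fun set" where
  "edge_space E = {J. \<forall>e. e \<notin> oriented_edges E \<longrightarrow> J $ e = 0}"

definition incidence_block ::
    "'n::{finite,linorder} set set \<Rightarrow> ('n \<times> 'n \<Rightarrow> real^'d^'d) \<Rightarrow> 'n \<Rightarrow> 'n \<times> 'n \<Rightarrow> real^'d^'d" where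
  "incidence_block E \<sigma> i e =
     (if e \<notin> oriented_edges E then 0
      else if fst e = i then mat 1
      else if snd e = i then - transpose (\<sigma> e)
      else 0)"

definition incidence ::
    "'n::{finite,linorder} set set \<Rightarrow> ('n \<times> 'n \<Rightarrow> real^'d^'d) \<Rightarrow> ('d::finite, 'n) edge_fun \<Rightarrow> ('d::finite, 'n) vertex_fun" where
  "incidence E \<sigma> J = (\<chi> i. \<Sum>e\<in>oriented_edges E. incidence_block E \<sigma> i e *v J $ e)"

definition incidence_transpose ::
    "'n::{finite,linorder} set set \<Rightarrow> ('n \<times> 'n \<Rightarrow> real^'d^'d) \<Rightarrow> ('d::finite, 'n) vertex_fun \<Rightarrow> ('d::finite, 'n) edge_fun" where
  "incidence_transpose E \<sigma> f = (\<chi> e. \<Sum>i\<in>UNIV. transpose (incidence_block E \<sigma> i e) *v f $ i)"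

lemma incidence_transpose_oriented_edge:
  fixes \<sigma> :: "'n::{finite,linorder} \<times> 'n \<Rightarrow> real^'d^'d"
  assumes "(i, j) \<in> oriented_edges E"
  shows "incidence_transpose E \<sigma> f $ (i, j) = f $ i - \<sigma> (i, j) *v f $ j"
proof -
  have ij: "i \<noteq> j" using assms by (auto simp: oriented_edges_def)
  have m: "transpose (- transpose (\<sigma> (i, j))) *v x = - (\<sigma> (i, j) *v x)" for x
    by (simp add: vec_eq_iff matrix_vector_mult_def transpose_def sum_negf)
  have z: "transpose (0 :: real^'d^'d) *v x = 0" for x
    by (simp add: vec_eq_iff matrix_vector_mult_def transpose_def)
  have "incidence_transpose E \<sigma> f $ (i, j) =
      (\<Sum>k\<in>UNIV. (if k = i then f $ i else 0) + (if k = j then - (\<sigma> (i, j) *v f $ j) else 0))"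
    unfolding incidence_transpose_def using assms ij
    by (auto simp: incidence_block_def m z transpose_mat matrix_vector_mul_lid simp del: transpose_matrix_vector
        intro!: sum.cong)
  also have "\<dots> = f $ i - \<sigma> (i, j) *v f $ j"
    by (simp add: sum.distrib)
  finally show ?thesis .
qed

definition l1_norm :: "real^'d^'n \<Rightarrow> real" where
  "l1_norm f = (\<Sum>i\<in>UNIV. \<Sum>k\<in>UNIV. \<bar>f $ i $ k\<bar>)"

text \<open>
  The entrywise maximum norm is the library's \<^const>\<open>infnorm\<close>, since the standard basis of
  \<open>real^'d^'n\<close> consists of the coordinate vectors of $\mathbb{R}^{nd}$.
\<close>

lemma infnorm_le_iff_entries:
  fixes x :: "real^'d^'n"
  shows "infnorm x \<le> \<delta> \<longleftrightarrow> (\<forall>i k. \<bar>x $ i $ k\<bar> \<le> \<delta>)"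
proof -
  have "infnorm x = Max ((\<lambda>b. \<bar>x \<bullet> b\<bar>) ` Basis)"
    by (simp add: infnorm_Max)
  then have "infnorm x \<le> \<delta> \<longleftrightarrow> (\<forall>b\<in>Basis. \<bar>x \<bullet> b\<bar> \<le> \<delta>)"
    by simp
  also have "\<dots> \<longleftrightarrow> (\<forall>i k. \<bar>x $ i $ k\<bar> \<le> \<delta>)"
    by (auto simp: Basis_vec_def inner_axis)
  finally show ?thesis .
qed

definition beckmann_objective ::
    "'n::{finite,linorder} set set \<Rightarrow> ('n \<Rightarrow> 'n \<Rightarrow> real) \<Rightarrow> real \<Rightarrow> ('d::finite, 'n) edge_fun \<Rightarrow> real" where
  "beckmann_objective E w lam J =
     (\<Sum>e\<in>oriented_edges E. w (fst e) (snd e) * norm (J $ e)) + lam / 2 * (norm J)\<^sup>2"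

definition beckmann_feasible ::
    "'n::{finite,linorder} set set \<Rightarrow> ('n \<times> 'n \<Rightarrow> real^'d^'d) \<Rightarrow> real \<Rightarrow>
     ('d::finite, 'n) vertex_fun \<Rightarrow> ('d::finite, 'n) vertex_fun \<Rightarrow> ('d::finite, 'n) edge_fun set" where
  "beckmann_feasible E \<sigma> \<delta> \<alpha> \<beta> =
     {J \<in> edge_space E. infnorm (incidence E \<sigma> J - (\<alpha> - \<beta>)) \<le> \<delta>}"

definition beckmann_value ::
    "'n::{finite,linorder} set set \<Rightarrow> ('n \<Rightarrow> 'n \<Rightarrow> real) \<Rightarrow> ('n \<times> 'n \<Rightarrow> real^'d^'d) \<Rightarrow>
     real \<Rightarrow> real \<Rightarrow> ('d::finite, 'n) vertex_fun \<Rightarrow> ('d::finite, 'n) vertex_fun \<Rightarrow> ereal" where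
  "beckmann_value E w \<sigma> \<delta> lam \<alpha> \<beta> =
     (INF J \<in> beckmann_feasible E \<sigma> \<delta> \<alpha> \<beta>. ereal (beckmann_objective E w lam J))"

text \<open>
  Below, \<open>1\<close> of type \<open>real^'d^'n\<close> is the all-ones vector and the order on this type is the
  elementwise one.
\<close>

definition lagrangian ::
    "'n::{finite,linorder} set set \<Rightarrow> ('n \<Rightarrow> 'n \<Rightarrow> real) \<Rightarrow> ('n \<times> 'n \<Rightarrow> real^'d^'d) \<Rightarrow>
     real \<Rightarrow> real \<Rightarrow> ('d::finite, 'n) vertex_fun \<Rightarrow> ('d::finite, 'n) edge_fun \<Rightarrow> ('d::finite, 'n) vertex_fun \<Rightarrow> ('d::finite, 'n) vertex_fun \<Rightarrow> real" where
  "lagrangian E w \<sigma> \<delta> lam c J \<xi>\<^sub>1 \<xi>\<^sub>2 =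
     beckmann_objective E w lam J
     + \<xi>\<^sub>1 \<bullet> (incidence E \<sigma> J - c - \<delta> *\<^sub>R 1)
     + \<xi>\<^sub>2 \<bullet> (- (incidence E \<sigma> J - c) - \<delta> *\<^sub>R 1)"

definition lagrange_dual_function ::
    "'n::{finite,linorder} set set \<Rightarrow> ('n \<Rightarrow> 'n \<Rightarrow> real) \<Rightarrow> ('n \<times> 'n \<Rightarrow> real^'d^'d) \<Rightarrow>
     real \<Rightarrow> real \<Rightarrow> ('d::finite, 'n) vertex_fun \<Rightarrow> ('d::finite, 'n) vertex_fun \<Rightarrow> ('d::finite, 'n) vertex_fun \<Rightarrow> ereal" where
  "lagrange_dual_function E w \<sigma> \<delta> lam c \<xi>\<^sub>1 \<xi>\<^sub>2 =
     (INF J \<in> edge_space E. ereal (lagrangian E w \<sigma> \<delta> lam c J \<xi>\<^sub>1 \<xi>\<^sub>2))"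

definition beckmann_dual_objective ::
    "'n::{finite,linorder} set set \<Rightarrow> ('n \<Rightarrow> 'n \<Rightarrow> real) \<Rightarrow> ('n \<times> 'n \<Rightarrow> real^'d^'d) \<Rightarrow>
     real \<Rightarrow> real \<Rightarrow> ('d::finite, 'n) vertex_fun \<Rightarrow> ('d::finite, 'n) vertex_fun \<Rightarrow> real" where
  "beckmann_dual_objective E w \<sigma> \<delta> lam c \<phi> =
     \<phi> \<bullet> c - \<delta> * l1_norm \<phi>
     - 1 / (2 * lam) * (\<Sum>e\<in>oriented_edges E.
         (max (norm (incidence_transpose E \<sigma> \<phi> $ e) - w (fst e) (snd e)) 0)\<^sup>2)"

end

theory Submission
  imports Defs
begin

text \<open>
  For fixed multipliers the Lagrangian decouples over the edges, and on each edge the minimisation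
  over \<open>J e\<close> is the proximal problem of a multiple of the Euclidean norm: its solution is the
  soft threshold of \<open>(B\<^sup>T \<phi>) e\<close>, and strong convexity makes the excess over the minimum at
  least \<open>lam / 2\<close> times the squared distance to it.

  The dual supremum need not be known to be attained beforehand, so strong duality is proved by
  maximising the dual objective minus \<open>\<epsilon> / 2 * (norm \<phi>)\<^sup>2\<close>, which is coercive. The optimality
  condition at the maximiser \<open>\<phi>\<^sub>\<epsilon>\<close> says that the edge-wise thresholding \<open>J\<^sub>\<epsilon>\<close> of \<open>B\<^sup>T \<phi>\<^sub>\<epsilon>\<close> is
  feasible up to the error \<open>\<epsilon> \<phi>\<^sub>\<epsilon>\<close> and that its cost plus \<open>\<epsilon> * (norm \<phi>\<^sub>\<epsilon>)\<^sup>2\<close> is at most the dual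
  value. If the dual is bounded, the errors vanish as \<open>\<epsilon>\<close> tends to 0 and the \<open>J\<^sub>\<epsilon>\<close> stay bounded, so
  that a limit point is feasible and has no duality gap.
\<close>

section \<open>The proximal problem of the Euclidean norm\<close>

definition soft_threshold :: "real \<Rightarrow> real \<Rightarrow> 'a::real_inner \<Rightarrow> 'a" where
  "soft_threshold lam w y =
     (if y = 0 then 0 else (max ((norm y - w) / lam) 0 / norm y) *\<^sub>R y)"

text \<open>If \<open>norm y \<le> w\<close>, the threshold is 0 and the bound is Cauchy-Schwarz.
  Otherwise it is \<open>k *\<^sub>R y\<close> with \<open>1 - lam * k = w / norm y\<close>, and
  expanding the squared distance again leaves Cauchy-Schwarz, scaled by \<open>1 - lam * k\<close>.
  The quadratic excess is what later gives uniqueness of the primal minimiser and smoothness of the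
  conjugate.\<close>

lemma soft_threshold_strong_min:
  fixes x y :: "'a::real_inner"
  assumes "lam > 0" "w \<ge> 0"
  shows "lam / 2 * (norm (x - soft_threshold lam w y))\<^sup>2 - 1 / (2 * lam) * (max (norm y - w) 0)\<^sup>2
    \<le> w * norm x + lam / 2 * (norm x)\<^sup>2 - y \<bullet> x"
proof (cases "norm y \<le> w")
  case True
  then have "soft_threshold lam w y = 0"
    using assms by (auto simp: soft_threshold_def max_def divide_le_0_iff intro: antisym)
  moreover have "y \<bullet> x \<le> w * norm x"
    using norm_cauchy_schwarz[of y x] mult_right_mono[OF True norm_ge_zero[of x]] by linarith
  ultimately show ?thesis
    using True by (simp add: max_def)
next
  case False
  define k where "k = (norm y - w) / lam / norm y"
  have ny: "norm y > 0" using False assms by linarith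
  have s: "soft_threshold lam w y = k *\<^sub>R y"
    using False ny assms by (auto simp: soft_threshold_def k_def max_def divide_le_0_iff)
  have k: "lam * k * norm y = norm y - w"
    using ny assms by (simp add: k_def)
  have sq: "(max (norm y - w) 0)\<^sup>2 = lam\<^sup>2 * k\<^sup>2 * (norm y)\<^sup>2"
    using False k by (simp add: max_def flip: power_mult_distrib)
  have e: "(norm (x - k *\<^sub>R y))\<^sup>2 = (norm x)\<^sup>2 - 2 * k * (y \<bullet> x) + k\<^sup>2 * (norm y)\<^sup>2"
    unfolding power2_norm_eq_inner
    by (simp add: inner_diff inner_commute power2_eq_square algebra_simps)
  \<comment> \<open>Once the squares cancel, the goal is
    \<open>(1 - lam * k) * (y \<bullet> x) \<le> w * norm x\<close>. The factor must be nonnegative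
    for Cauchy-Schwarz to be multiplied by it.\<close>
  have "(1 - lam * k) * norm y = w" using k by (simp add: algebra_simps)
  moreover have "1 - lam * k \<ge> 0"
    using calculation ny assms(2) by (metis zero_le_mult_iff not_less)
  ultimately have "(1 - lam * k) * (y \<bullet> x) \<le> w * norm x"
    using mult_left_mono[OF norm_cauchy_schwarz[of y x], of "1 - lam * k"]
    by (metis mult.assoc)
  then show ?thesis
    unfolding s sq e using assms by (simp add: field_simps power2_eq_square)
qed

text \<open>The threshold is a nonnegative multiple of \<open>y\<close>, so Cauchy-Schwarz is tight.
  Writing t for its norm, \<open>norm y - w = lam * t\<close> above the threshold level and the left
  side collapses to minus \<open>lam / 2\<close> times the square of t.\<close>

lemma soft_threshold_min_value:
  fixes y :: "'a::real_inner"
  assumes "lam > 0" "w \<ge> 0"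
  shows "w * norm (soft_threshold lam w y) + lam / 2 * (norm (soft_threshold lam w y))\<^sup>2
      - y \<bullet> soft_threshold lam w y
    = - (1 / (2 * lam) * (max (norm y - w) 0)\<^sup>2)"
proof (cases "norm y \<le> w")
  case True
  then have "soft_threshold lam w y = 0"
    using assms by (auto simp: soft_threshold_def max_def divide_le_0_iff intro: antisym)
  then show ?thesis using True by (simp add: max_def)
next
  case False
  define k where "k = (norm y - w) / lam / norm y"
  have ny: "norm y > 0" using False assms by linarith
  have s: "soft_threshold lam w y = k *\<^sub>R y"
    using False ny assms by (auto simp: soft_threshold_def k_def max_def divide_le_0_iff)
  have k0: "k \<ge> 0" using False ny assms by (simp add: k_def)
  have kn: "k * norm y = (norm y - w) / lam"
    using ny by (simp add: k_def)
  have n: "norm (k *\<^sub>R y) = (norm y - w) / lam" using k0 kn by simp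
  have i: "y \<bullet> (k *\<^sub>R y) = norm y * ((norm y - w) / lam)"
    unfolding kn[symmetric] by (simp add: power2_norm_eq_inner[symmetric] power2_eq_square)
  show ?thesis
    unfolding s n i using False assms by (simp add: max_def field_simps power2_eq_square)
qed

section \<open>Edge-wise thresholding and the conjugate of the flow cost\<close>

definition edge_threshold ::
    "'n::{finite,linorder} set set \<Rightarrow> ('n \<Rightarrow> 'n \<Rightarrow> real) \<Rightarrow> real \<Rightarrow>
     ('d::finite, 'n) edge_fun \<Rightarrow> ('d, 'n) edge_fun" where
  "edge_threshold E w lam Y =
     (\<chi> e. if e \<in> oriented_edges E then soft_threshold lam (w (fst e) (snd e)) (Y $ e) else 0)"

text \<open>For \<open>lam > 0\<close> and nonnegative weights this is the Fenchel conjugate of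
  \<open>beckmann_objective E w lam\<close> on \<open>edge_space E\<close>, and
  \<open>edge_threshold E w lam\<close> is its gradient.\<close>

definition edge_conjugate ::
    "'n::{finite,linorder} set set \<Rightarrow> ('n \<Rightarrow> 'n \<Rightarrow> real) \<Rightarrow> real \<Rightarrow> ('d::finite, 'n) edge_fun \<Rightarrow> real" where
  "edge_conjugate E w lam Y =
     1 / (2 * lam) * (\<Sum>e\<in>oriented_edges E. (max (norm (Y $ e) - w (fst e) (snd e)) 0)\<^sup>2)"

lemma edge_threshold_in_edge_space: "edge_threshold E w lam Y \<in> edge_space E"
  by (simp add: edge_threshold_def edge_space_def)

lemma diff_in_edge_space: "J \<in> edge_space E \<Longrightarrow> K \<in> edge_space E \<Longrightarrow> J - K \<in> edge_space E"
  by (simp add: edge_space_def)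

lemma inner_edge_space:
  assumes "J \<in> edge_space E"
  shows "Y \<bullet> J = (\<Sum>e\<in>oriented_edges E. Y $ e \<bullet> J $ e)"
  unfolding inner_vec_def
  by (rule sum.mono_neutral_right) (use assms in \<open>auto simp: edge_space_def\<close>)

lemma norm_edge_space:
  assumes "J \<in> edge_space E"
  shows "(norm J)\<^sup>2 = (\<Sum>e\<in>oriented_edges E. (norm (J $ e))\<^sup>2)"
  using inner_edge_space[OF assms, of J] by (simp add: power2_norm_eq_inner)

lemma beckmann_objective_edge_sum:
  assumes "J \<in> edge_space E"
  shows "beckmann_objective E w lam J - Y \<bullet> J =
    (\<Sum>e\<in>oriented_edges E. w (fst e) (snd e) * norm (J $ e) + lam / 2 * (norm (J $ e))\<^sup>2 - Y $ e \<bullet> J $ e)"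
  unfolding beckmann_objective_def norm_edge_space[OF assms] inner_edge_space[OF assms]
  by (simp add: sum.distrib sum_subtractf sum_distrib_left)

lemma edge_threshold_strong_min:
  assumes "lam > 0" "\<forall>i j. w i j \<ge> 0" "J \<in> edge_space E"
  shows "lam / 2 * (norm (J - edge_threshold E w lam Y))\<^sup>2 - edge_conjugate E w lam Y
    \<le> beckmann_objective E w lam J - Y \<bullet> J"
  unfolding beckmann_objective_edge_sum[OF assms(3)] edge_conjugate_def sum_distrib_left
    norm_edge_space[OF diff_in_edge_space[OF assms(3) edge_threshold_in_edge_space]]
    sum_subtractf[symmetric]
  by (rule sum_mono) (use soft_threshold_strong_min[OF assms(1) assms(2)[rule_format]] in \<open>simp add: edge_threshold_def\<close>)

lemma edge_threshold_min_value:
  assumes "lam > 0" "\<forall>i j. w i j \<ge> 0"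
  shows "beckmann_objective E w lam (edge_threshold E w lam Y) - Y \<bullet> edge_threshold E w lam Y
    = - edge_conjugate E w lam Y"
  unfolding beckmann_objective_edge_sum[OF edge_threshold_in_edge_space] edge_conjugate_def
    sum_distrib_left sum_negf[symmetric]
  by (rule sum.cong) (use soft_threshold_min_value[OF assms(1) assms(2)[rule_format]] in \<open>simp_all add: edge_threshold_def\<close>)

text \<open>
  The conjugate of a \<open>lam\<close>-strongly convex function has a \<open>1 / lam\<close>-Lipschitz gradient.
\<close>

lemma edge_conjugate_descent:
  fixes Y H :: "('d::finite, 'n::{finite,linorder}) edge_fun"
  assumes lam: "lam > 0" and w: "\<forall>i j. w i j \<ge> 0"
  shows "edge_conjugate E w lam (Y + H)
    \<le> edge_conjugate E w lam Y + H \<bullet> edge_threshold E w lam Y + (norm H)\<^sup>2 / (2 * lam)"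
proof -
  define K where "K = edge_threshold E w lam (Y + H)"
  define D where "D = K - edge_threshold E w lam Y"
  \<comment> \<open>The minimiser \<open>K\<close> for \<open>Y + H\<close> is tested in the strong
    minimality inequality for \<open>Y\<close>. Only \<open>H \<bullet> D\<close> minus the
    quadratic excess then remains to be estimated, and Young's inequality does this with matching
    constants.\<close>
  have "lam / 2 * (norm D)\<^sup>2 - edge_conjugate E w lam Y \<le> beckmann_objective E w lam K - Y \<bullet> K"
    unfolding D_def K_def by (rule edge_threshold_strong_min[OF lam w edge_threshold_in_edge_space])
  moreover have "beckmann_objective E w lam K - (Y + H) \<bullet> K = - edge_conjugate E w lam (Y + H)"
    unfolding K_def by (rule edge_threshold_min_value[OF lam w])
  moreover have "H \<bullet> D \<le> lam / 2 * (norm D)\<^sup>2 + (norm H)\<^sup>2 / (2 * lam)"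
  proof -
    have "0 \<le> (norm (lam *\<^sub>R D - H))\<^sup>2 / (2 * lam)" using lam by simp
    also have "\<dots> = lam / 2 * (norm D)\<^sup>2 + (norm H)\<^sup>2 / (2 * lam) - H \<bullet> D"
      using lam unfolding power2_norm_eq_inner
      by (simp add: inner_diff inner_commute field_simps power2_eq_square)
    finally show ?thesis by simp
  qed
  ultimately show ?thesis by (simp add: D_def inner_add_left inner_diff_right)
qed

section \<open>Adjoint incidence operators and the duality of the l1 and maximum norms\<close>

lemma incidence_transpose_adjoint:
  fixes J :: "('d::finite, 'n::{finite,linorder}) edge_fun"
  assumes "J \<in> edge_space E"
  shows "incidence_transpose E \<sigma> \<phi> \<bullet> J = \<phi> \<bullet> incidence E \<sigma> J"
proof -
  have "incidence_transpose E \<sigma> \<phi> \<bullet> J =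
      (\<Sum>e\<in>oriented_edges E. \<Sum>i\<in>UNIV. \<phi> $ i \<bullet> (incidence_block E \<sigma> i e *v J $ e))"
    unfolding inner_edge_space[OF assms]
    by (simp add: incidence_transpose_def inner_sum_left dot_lmul_matrix)
  also have "\<dots> = \<phi> \<bullet> incidence E \<sigma> J"
    by (subst sum.swap) (simp add: inner_vec_def[of \<phi>] incidence_def inner_sum_right)
  finally show ?thesis .
qed

lemma linear_incidence_transpose:
  "linear (incidence_transpose E \<sigma> :: ('d::finite, 'n::{finite,linorder}) vertex_fun \<Rightarrow> _)"
  by (rule linearI)
    (simp_all add: incidence_transpose_def vec_eq_iff matrix_vector_right_distrib sum.distrib
      vector_matrix_left_distrib scaleR_vector_matrix_assoc scaleR_sum_right sum_distrib_left)

lemma linear_incidence: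
  "linear (incidence E \<sigma> :: ('d::finite, 'n::{finite,linorder}) edge_fun \<Rightarrow> _)"
  by (rule linearI)
    (simp_all add: incidence_def vec_eq_iff matrix_vector_right_distrib sum.distrib
      matrix_vector_mult_scaleR scaleR_sum_right sum_distrib_left)

lemma inner_vertex_fun: "\<phi> \<bullet> (r :: real^'d^'n) = (\<Sum>i\<in>UNIV. \<Sum>k\<in>UNIV. \<phi> $ i $ k * r $ i $ k)"
  by (simp add: inner_vec_def)

lemma inner_le_l1_norm:
  fixes \<phi> r :: "real^'d^'n"
  assumes "infnorm r \<le> \<delta>"
  shows "\<phi> \<bullet> r \<le> \<delta> * l1_norm \<phi>"
proof -
  have "\<phi> $ i $ k * r $ i $ k \<le> \<delta> * \<bar>\<phi> $ i $ k\<bar>" for i k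
    using assms[unfolded infnorm_le_iff_entries, rule_format, of i k]
      abs_ge_self[of "\<phi> $ i $ k * r $ i $ k"] mult_left_mono[of "\<bar>r $ i $ k\<bar>" \<delta> "\<bar>\<phi> $ i $ k\<bar>"]
    by (simp add: abs_mult mult.commute)
  then show ?thesis
    unfolding inner_vertex_fun l1_norm_def sum_distrib_left by (intro sum_mono)
qed

lemma l1_norm_scaleR: "l1_norm (a *\<^sub>R \<phi>) = \<bar>a\<bar> * l1_norm \<phi>"
  by (simp add: l1_norm_def abs_mult sum_distrib_left)

lemma l1_norm_triangle: "l1_norm (\<phi> + \<psi>) \<le> l1_norm \<phi> + l1_norm \<psi>"
  unfolding l1_norm_def sum.distrib[symmetric] by (intro sum_mono) simp

lemma l1_norm_nonneg: "0 \<le> l1_norm \<phi>"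
  unfolding l1_norm_def by (intro sum_nonneg) simp

lemma l1_norm_axis: "l1_norm (axis i (axis k a)) = \<bar>a\<bar>"
proof -
  have "\<bar>axis i (axis k a) $ j $ l\<bar> = (if l = k then if j = i then \<bar>a\<bar> else 0 else 0)" for j l
    by (simp add: axis_def)
  then show ?thesis
    unfolding l1_norm_def by simp
qed

section \<open>The duality gap and the Lagrange dual\<close>

lemma beckmann_dual_objective_alt:
  "beckmann_dual_objective E w \<sigma> \<delta> lam c \<phi> =
     \<phi> \<bullet> c - \<delta> * l1_norm \<phi> - edge_conjugate E w lam (incidence_transpose E \<sigma> \<phi>)"
  by (simp add: beckmann_dual_objective_def edge_conjugate_def)

text \<open>Hoelder's inequality applied to the residual of \<open>J\<close> bounds the linear part
  of the dual by the pairing of \<open>J\<close> with the transposed incidence of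
  \<open>\<phi>\<close>; strong minimality of the threshold does the rest. This is weak duality with
  a remainder, so a flow without gap must equal the threshold.\<close>

lemma beckmann_gap:
  assumes lam: "lam > 0" and w: "\<forall>i j. w i j \<ge> 0"
    and J: "J \<in> beckmann_feasible E \<sigma> \<delta> \<alpha> \<beta>"
  shows "beckmann_dual_objective E w \<sigma> \<delta> lam (\<alpha> - \<beta>) \<phi>
      + lam / 2 * (norm (J - edge_threshold E w lam (incidence_transpose E \<sigma> \<phi>)))\<^sup>2
    \<le> beckmann_objective E w lam J"
proof -
  have JE: "J \<in> edge_space E" and inf: "infnorm (incidence E \<sigma> J - (\<alpha> - \<beta>)) \<le> \<delta>"
    using J by (auto simp: beckmann_feasible_def)
  \<comment> \<open>The sign is flipped because a lower bound on
    \<open>\<phi> \<bullet> incidence E \<sigma> J\<close> is wanted.\<close>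
  have "(- \<phi>) \<bullet> (incidence E \<sigma> J - (\<alpha> - \<beta>)) \<le> \<delta> * l1_norm (- \<phi>)"
    by (rule inner_le_l1_norm[OF inf])
  then have "\<phi> \<bullet> (\<alpha> - \<beta>) - \<delta> * l1_norm \<phi> \<le> incidence_transpose E \<sigma> \<phi> \<bullet> J"
    using l1_norm_scaleR[of "-1" \<phi>]
    by (simp add: incidence_transpose_adjoint[OF JE] inner_diff_right)
  with edge_threshold_strong_min[OF lam w JE, of "incidence_transpose E \<sigma> \<phi>"] show ?thesis
    by (simp add: beckmann_dual_objective_alt)
qed

text \<open>Separates the two roles of the multipliers: their difference is all that couples to
  \<open>J\<close> and \<open>c\<close>, while their sum enters only through the
  \<open>\<delta>\<close> term. This is why the dual can be expressed in the difference
  alone.\<close>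

lemma lagrangian_alt:
  assumes "J \<in> edge_space E"
  shows "lagrangian E w \<sigma> \<delta> lam c J \<xi>\<^sub>1 \<xi>\<^sub>2 =
    beckmann_objective E w lam J - incidence_transpose E \<sigma> (\<xi>\<^sub>2 - \<xi>\<^sub>1) \<bullet> J
    + (\<xi>\<^sub>2 - \<xi>\<^sub>1) \<bullet> c - \<delta> * ((\<xi>\<^sub>1 + \<xi>\<^sub>2) \<bullet> 1)"
  by (simp add: lagrangian_def incidence_transpose_adjoint[OF assms] inner_add_left inner_diff_left
      inner_diff_right inner_minus_right algebra_simps)

lemma lagrange_dual_function_eq:
  fixes c \<xi>\<^sub>1 \<xi>\<^sub>2 :: "('d::finite, 'n::{finite,linorder}) vertex_fun"
  assumes lam: "lam > 0" and w: "\<forall>i j. w i j \<ge> 0"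
  shows "lagrange_dual_function E w \<sigma> \<delta> lam c \<xi>\<^sub>1 \<xi>\<^sub>2 =
    ereal ((\<xi>\<^sub>2 - \<xi>\<^sub>1) \<bullet> c - \<delta> * ((\<xi>\<^sub>1 + \<xi>\<^sub>2) \<bullet> 1)
      - edge_conjugate E w lam (incidence_transpose E \<sigma> (\<xi>\<^sub>2 - \<xi>\<^sub>1)))"
    (is "_ = ereal ?v")
  unfolding lagrange_dual_function_def
proof (rule antisym)
  let ?Y = "incidence_transpose E \<sigma> (\<xi>\<^sub>2 - \<xi>\<^sub>1)"
  have "lagrangian E w \<sigma> \<delta> lam c (edge_threshold E w lam ?Y) \<xi>\<^sub>1 \<xi>\<^sub>2 = ?v"
    unfolding lagrangian_alt[OF edge_threshold_in_edge_space] edge_threshold_min_value[OF lam w]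
    by simp
  then show "(INF J\<in>edge_space E. ereal (lagrangian E w \<sigma> \<delta> lam c J \<xi>\<^sub>1 \<xi>\<^sub>2)) \<le> ereal ?v"
    by (metis INF_lower edge_threshold_in_edge_space)
  show "ereal ?v \<le> (INF J\<in>edge_space E. ereal (lagrangian E w \<sigma> \<delta> lam c J \<xi>\<^sub>1 \<xi>\<^sub>2))"
  proof (rule INF_greatest)
    fix J :: "('d, 'n) edge_fun" assume J: "J \<in> edge_space E"
    have "0 \<le> lam / 2 * (norm (J - edge_threshold E w lam ?Y))\<^sup>2" using lam by simp
    with edge_threshold_strong_min[OF lam w J, of ?Y]
    show "ereal ?v \<le> ereal (lagrangian E w \<sigma> \<delta> lam c J \<xi>\<^sub>1 \<xi>\<^sub>2)"
      unfolding lagrangian_alt[OF J] by simp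
  qed
qed

text \<open>For a fixed difference \<open>\<phi>\<close> the dual function is largest when the sum
  of the multipliers is smallest, as \<open>\<delta> \<ge> 0\<close>. That sum dominates the
  entrywise absolute value of \<open>\<phi>\<close>, with equality for the negative and positive
  parts \<open>n\<close> and \<open>p\<close>.\<close>

lemma SUP_lagrange_dual_function:
  fixes c \<phi> :: "('d::finite, 'n::{finite,linorder}) vertex_fun"
  assumes lam: "lam > 0" and w: "\<forall>i j. w i j \<ge> 0" and \<delta>: "\<delta> \<ge> 0"
  shows "(SUP (\<xi>\<^sub>1, \<xi>\<^sub>2) \<in> {(\<xi>\<^sub>1, \<xi>\<^sub>2). 0 \<le> \<xi>\<^sub>1 \<and> 0 \<le> \<xi>\<^sub>2 \<and> \<phi> = \<xi>\<^sub>2 - \<xi>\<^sub>1}.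
      lagrange_dual_function E w \<sigma> \<delta> lam c \<xi>\<^sub>1 \<xi>\<^sub>2)
    = ereal (beckmann_dual_objective E w \<sigma> \<delta> lam c \<phi>)"
proof (rule antisym)
  show "(SUP (\<xi>\<^sub>1, \<xi>\<^sub>2) \<in> {(\<xi>\<^sub>1, \<xi>\<^sub>2). 0 \<le> \<xi>\<^sub>1 \<and> 0 \<le> \<xi>\<^sub>2 \<and> \<phi> = \<xi>\<^sub>2 - \<xi>\<^sub>1}.
      lagrange_dual_function E w \<sigma> \<delta> lam c \<xi>\<^sub>1 \<xi>\<^sub>2)
    \<le> ereal (beckmann_dual_objective E w \<sigma> \<delta> lam c \<phi>)"
  proof (rule SUP_least, clarify)
    fix \<xi>\<^sub>1 \<xi>\<^sub>2 :: "('d, 'n) vertex_fun"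
    assume "0 \<le> \<xi>\<^sub>1" "0 \<le> \<xi>\<^sub>2"
    then have "0 \<le> \<xi>\<^sub>1 $ i $ k" "0 \<le> \<xi>\<^sub>2 $ i $ k" for i k
      by (simp_all add: less_eq_vec_def)
    then have "\<bar>(\<xi>\<^sub>2 - \<xi>\<^sub>1) $ i $ k\<bar> \<le> (\<xi>\<^sub>1 + \<xi>\<^sub>2) $ i $ k" for i k
      by (simp add: abs_le_iff)
    then have "l1_norm (\<xi>\<^sub>2 - \<xi>\<^sub>1) \<le> (\<xi>\<^sub>1 + \<xi>\<^sub>2) \<bullet> 1"
      unfolding inner_vertex_fun l1_norm_def by (intro sum_mono) simp
    from mult_left_mono[OF this \<delta>]
    show "lagrange_dual_function E w \<sigma> \<delta> lam c \<xi>\<^sub>1 \<xi>\<^sub>2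
      \<le> ereal (beckmann_dual_objective E w \<sigma> \<delta> lam c (\<xi>\<^sub>2 - \<xi>\<^sub>1))"
      by (simp add: lagrange_dual_function_eq[OF lam w] beckmann_dual_objective_alt)
  qed
  define p where "p = (\<chi> i k. max (\<phi> $ i $ k) 0)"
  define n where "n = (\<chi> i k. max (- \<phi> $ i $ k) 0)"
  have "(n + p) $ i $ k = \<bar>\<phi> $ i $ k\<bar>" for i k
    by (simp add: n_def p_def)
  then have l1: "(n + p) \<bullet> 1 = l1_norm \<phi>"
    unfolding inner_vertex_fun l1_norm_def by simp
  have \<phi>: "p - n = \<phi>" by (auto simp: p_def n_def vec_eq_iff)
  have np: "0 \<le> n" "0 \<le> p" by (simp_all add: p_def n_def less_eq_vec_def)
  have "lagrange_dual_function E w \<sigma> \<delta> lam c n p = ereal (beckmann_dual_objective E w \<sigma> \<delta> lam c \<phi>)"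
    unfolding lagrange_dual_function_eq[OF lam w] \<phi> l1 beckmann_dual_objective_alt by simp
  moreover have "(n, p) \<in> {(\<xi>\<^sub>1, \<xi>\<^sub>2). 0 \<le> \<xi>\<^sub>1 \<and> 0 \<le> \<xi>\<^sub>2 \<and> \<phi> = \<xi>\<^sub>2 - \<xi>\<^sub>1}"
    using np \<phi> by simp
  ultimately show "ereal (beckmann_dual_objective E w \<sigma> \<delta> lam c \<phi>)
    \<le> (SUP (\<xi>\<^sub>1, \<xi>\<^sub>2) \<in> {(\<xi>\<^sub>1, \<xi>\<^sub>2). 0 \<le> \<xi>\<^sub>1 \<and> 0 \<le> \<xi>\<^sub>2 \<and> \<phi> = \<xi>\<^sub>2 - \<xi>\<^sub>1}.
      lagrange_dual_function E w \<sigma> \<delta> lam c \<xi>\<^sub>1 \<xi>\<^sub>2)"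
    by (intro SUP_upper2[of "(n, p)"]) auto
qed

section \<open>The regularised dual and its optimality conditions\<close>

lemma edge_conjugate_nonneg: "lam > 0 \<Longrightarrow> 0 \<le> edge_conjugate E w lam Y"
  by (simp add: edge_conjugate_def sum_nonneg)

lemma beckmann_dual_objective_zero:
  assumes "\<forall>i j. w i j \<ge> 0"
  shows "beckmann_dual_objective E w \<sigma> \<delta> lam c 0 = 0"
proof -
  have "incidence_transpose E \<sigma> 0 = 0" by (rule linear_0[OF linear_incidence_transpose])
  then show ?thesis using assms by (simp add: beckmann_dual_objective_def l1_norm_def max_def)
qed

lemma continuous_beckmann_dual_objective:
  "continuous_on UNIV (beckmann_dual_objective E w \<sigma> \<delta> lam c)"
  unfolding beckmann_dual_objective_def l1_norm_def
  by (intro continuous_intros linear_continuous_on linear_conv_bounded_linear[THEN iffD1]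
      linear_incidence_transpose)

lemma regularized_dual_attained:
  assumes lam: "lam > 0" and w: "\<forall>i j. w i j \<ge> 0" and \<delta>: "\<delta> \<ge> 0" and \<epsilon>: "\<epsilon> > 0"
  obtains \<phi> where "\<And>\<psi>. beckmann_dual_objective E w \<sigma> \<delta> lam c \<psi> - \<epsilon> / 2 * (norm \<psi>)\<^sup>2
    \<le> beckmann_dual_objective E w \<sigma> \<delta> lam c \<phi> - \<epsilon> / 2 * (norm \<phi>)\<^sup>2"
proof -
  let ?g = "\<lambda>\<psi>. beckmann_dual_objective E w \<sigma> \<delta> lam c \<psi> - \<epsilon> / 2 * (norm \<psi>)\<^sup>2"
  \<comment> \<open>Beyond this radius \<open>\<epsilon> / 2 * (norm \<psi>)\<^sup>2\<close>
    dominates the Cauchy-Schwarz bound on \<open>\<psi> \<bullet> c\<close>, so the value is at most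
    the one at 0; a maximum over the compact ball is therefore global.\<close>
  let ?R = "2 * norm c / \<epsilon>"
  have R: "0 \<le> ?R" using \<epsilon> by simp
  have "continuous_on (cball 0 ?R) ?g"
    by (intro continuous_intros continuous_on_subset[OF continuous_beckmann_dual_objective]) simp
  then obtain \<phi> where \<phi>: "\<And>\<psi>. \<psi> \<in> cball 0 ?R \<Longrightarrow> ?g \<psi> \<le> ?g \<phi>"
    using continuous_attains_sup[of "cball 0 ?R" ?g] R cball_eq_empty[of 0 ?R] compact_cball
    by (meson not_less)
  show ?thesis
  proof (rule that[of \<phi>])
    fix \<psi>
    show "?g \<psi> \<le> ?g \<phi>"
    proof (cases "\<psi> \<in> cball 0 ?R")
      case False
      then have "norm c \<le> \<epsilon> / 2 * norm \<psi>" using \<epsilon> by (simp add: field_simps)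
      from mult_right_mono[OF this norm_ge_zero[of \<psi>]]
      have "\<psi> \<bullet> c \<le> \<epsilon> / 2 * (norm \<psi>)\<^sup>2"
        using norm_cauchy_schwarz[of \<psi> c] by (simp add: power2_eq_square mult_ac)
      moreover have "0 \<le> \<delta> * l1_norm \<psi>" using \<delta> by (simp add: l1_norm_nonneg)
      ultimately have "?g \<psi> \<le> ?g 0"
        using edge_conjugate_nonneg[OF lam, of E w "incidence_transpose E \<sigma> \<psi>"]
        unfolding beckmann_dual_objective_zero[OF w] by (simp add: beckmann_dual_objective_alt)
      also have "\<dots> \<le> ?g \<phi>" using R by (intro \<phi>) simp
      finally show ?thesis .
    qed (rule \<phi>)
  qed
qed

text \<open>Divide by \<open>t\<close> and let it decrease to 0. This one-sided first-order
  condition takes the place of a derivative, since the l1 norm is not differentiable.\<close>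

lemma le_of_quadratic_perturbation:
  fixes a b K :: real
  assumes "\<And>t. 0 < t \<Longrightarrow> t < 1 \<Longrightarrow> t * a - K * t\<^sup>2 \<le> t * b"
  shows "a \<le> b"
proof (rule tendsto_upperbound)
  show "((\<lambda>t. a - K * t) \<longlongrightarrow> a) (at_right 0)"
    by (auto intro!: tendsto_eq_intros)
  have "a - K * t \<le> b" if "0 < t" "t < 1" for t
  proof -
    have "t * (a - K * t) \<le> t * b"
      using assms[OF that] by (simp add: algebra_simps power2_eq_square)
    then show ?thesis using that by simp
  qed
  then show "eventually (\<lambda>t. a - K * t \<le> b) (at_right 0)"
    unfolding eventually_at_right_field by (intro exI[of _ 1]) auto
qed simp

text \<open>The gradient at \<open>\<phi>\<close> of the smooth part of the regularised objective is
  \<open>r\<close>, and maximality makes it a subgradient of \<open>\<delta>\<close> times the l1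
  norm. Coordinate directions yield the entrywise bound; the direction \<open>- \<phi>\<close>
  yields the complementary slackness that turns into the cost estimate.\<close>

lemma regularized_dual_optimality:
  fixes \<phi> c :: "('d::finite, 'n::{finite,linorder}) vertex_fun"
  assumes lam: "lam > 0" and w: "\<forall>i j. w i j \<ge> 0" and \<delta>: "\<delta> \<ge> 0"
    and max: "\<And>\<psi>. beckmann_dual_objective E w \<sigma> \<delta> lam c \<psi> - \<epsilon> / 2 * (norm \<psi>)\<^sup>2
      \<le> beckmann_dual_objective E w \<sigma> \<delta> lam c \<phi> - \<epsilon> / 2 * (norm \<phi>)\<^sup>2"
  defines "J \<equiv> edge_threshold E w lam (incidence_transpose E \<sigma> \<phi>)"
  shows "infnorm (incidence E \<sigma> J - c + \<epsilon> *\<^sub>R \<phi>) \<le> \<delta>"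
    and "beckmann_objective E w lam J + \<epsilon> * (norm \<phi>)\<^sup>2 \<le> beckmann_dual_objective E w \<sigma> \<delta> lam c \<phi>"
proof -
  let ?A = "incidence_transpose E \<sigma>"
  define r where "r = c - incidence E \<sigma> J - \<epsilon> *\<^sub>R \<phi>"
  have JE: "J \<in> edge_space E" unfolding J_def by (rule edge_threshold_in_edge_space)
  \<comment> \<open>Here \<open>b\<close> is any linear rate bounding the growth of the l1 norm
    along \<open>h\<close>; it may be negative. The remaining terms are linear in \<open>t\<close>
    up to a quadratic error, by the descent inequality.\<close>
  have var: "h \<bullet> r \<le> \<delta> * b"
    if b: "\<And>t. 0 < t \<Longrightarrow> t < 1 \<Longrightarrow> l1_norm (\<phi> + t *\<^sub>R h) \<le> l1_norm \<phi> + t * b" for h b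
  proof (rule le_of_quadratic_perturbation)
    fix t :: real assume t: "0 < t" "t < 1"
    have "edge_conjugate E w lam (?A \<phi> + t *\<^sub>R ?A h)
        \<le> edge_conjugate E w lam (?A \<phi>) + (t *\<^sub>R ?A h) \<bullet> J + (norm (t *\<^sub>R ?A h))\<^sup>2 / (2 * lam)"
      unfolding J_def by (rule edge_conjugate_descent[OF lam w])
    moreover have "?A (\<phi> + t *\<^sub>R h) = ?A \<phi> + t *\<^sub>R ?A h"
      by (simp add: linear_add[OF linear_incidence_transpose] linear_scale[OF linear_incidence_transpose])
    moreover have "(norm (\<phi> + t *\<^sub>R h))\<^sup>2 = (norm \<phi>)\<^sup>2 + 2 * t * (h \<bullet> \<phi>) + t\<^sup>2 * (norm h)\<^sup>2"
      unfolding power2_norm_eq_inner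
      by (simp add: inner_add inner_commute power2_eq_square algebra_simps)
    moreover have "\<delta> * l1_norm (\<phi> + t *\<^sub>R h) \<le> \<delta> * (l1_norm \<phi> + t * b)"
      by (rule mult_left_mono[OF b[OF t] \<delta>])
    ultimately show "t * (h \<bullet> r) - ((norm (?A h))\<^sup>2 / (2 * lam) + \<epsilon> / 2 * (norm h)\<^sup>2) * t\<^sup>2
        \<le> t * (\<delta> * b)"
      using max[of "\<phi> + t *\<^sub>R h"]
      by (simp add: r_def beckmann_dual_objective_alt incidence_transpose_adjoint[OF JE]
          inner_add_left inner_diff_right power_mult_distrib algebra_simps)
  qed
  have "infnorm r \<le> \<delta>"
    unfolding infnorm_le_iff_entries
  proof (intro allI)
    fix i k
    have "axis i (axis k s) \<bullet> r \<le> \<delta>" if "\<bar>s\<bar> = 1" for s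
    proof -
      have "axis i (axis k s) \<bullet> r \<le> \<delta> * 1"
      proof (rule var)
        fix t :: real assume "0 < t"
        then show "l1_norm (\<phi> + t *\<^sub>R axis i (axis k s)) \<le> l1_norm \<phi> + t * 1"
          using l1_norm_triangle[of \<phi> "t *\<^sub>R axis i (axis k s)"] that
          by (simp add: l1_norm_scaleR l1_norm_axis)
      qed
      then show ?thesis by simp
    qed
    from this[of 1] this[of "-1"] show "\<bar>r $ i $ k\<bar> \<le> \<delta>"
      by (simp add: inner_axis' abs_le_iff)
  qed
  then show "infnorm (incidence E \<sigma> J - c + \<epsilon> *\<^sub>R \<phi>) \<le> \<delta>"
    using infnorm_neg[of r] by (simp add: r_def algebra_simps)
  \<comment> \<open>Shrinking \<open>\<phi>\<close> towards 0 lowers the l1 norm exactly linearly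
    for \<open>t < 1\<close>, so the rate is minus the norm itself.\<close>
  have "(- \<phi>) \<bullet> r \<le> \<delta> * (- l1_norm \<phi>)"
  proof (rule var)
    fix t :: real assume "0 < t" "t < 1"
    then have "l1_norm ((1 - t) *\<^sub>R \<phi>) = (1 - t) * l1_norm \<phi>" by (simp add: l1_norm_scaleR)
    then show "l1_norm (\<phi> + t *\<^sub>R - \<phi>) \<le> l1_norm \<phi> + t * - l1_norm \<phi>"
      by (simp add: algebra_simps)
  qed
  then have "\<phi> \<bullet> incidence E \<sigma> J + \<epsilon> * (norm \<phi>)\<^sup>2 \<le> \<phi> \<bullet> c - \<delta> * l1_norm \<phi>"
    by (simp add: r_def inner_diff_right power2_norm_eq_inner algebra_simps)
  moreover have "beckmann_objective E w lam J - ?A \<phi> \<bullet> J = - edge_conjugate E w lam (?A \<phi>)"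
    unfolding J_def by (rule edge_threshold_min_value[OF lam w])
  ultimately show "beckmann_objective E w lam J + \<epsilon> * (norm \<phi>)\<^sup>2
      \<le> beckmann_dual_objective E w \<sigma> \<delta> lam c \<phi>"
    by (simp add: beckmann_dual_objective_alt incidence_transpose_adjoint[OF JE])
qed

section \<open>Limits of the regularised solutions\<close>

lemma beckmann_objective_ge:
  assumes "\<forall>i j. w i j \<ge> 0"
  shows "lam / 2 * (norm J)\<^sup>2 \<le> beckmann_objective E w lam J"
  using assms by (simp add: beckmann_objective_def sum_nonneg)

lemma continuous_beckmann_objective: "continuous_on UNIV (beckmann_objective E w lam)"
  unfolding beckmann_objective_def by (intro continuous_intros)

lemma closed_edge_space: "closed (edge_space E :: ('d::finite, 'n::{finite,linorder}) edge_fun set)"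
proof -
  have "edge_space E = (\<Inter>e\<in>- oriented_edges E. {J :: ('d, 'n) edge_fun. J $ e = 0})"
    by (auto simp: edge_space_def)
  then show ?thesis by (auto intro!: closed_INT closed_Collect_eq continuous_intros)
qed

text \<open>Only a bound on the dual is assumed, not attainment. Hence the result serves both strong
  duality, with \<open>M\<close> an arbitrary upper bound, and the description of minimisers, with
  \<open>M\<close> the dual maximum.\<close>

lemma beckmann_feasible_of_bounded_dual:
  fixes \<alpha> \<beta> :: "('d::finite, 'n::{finite,linorder}) vertex_fun"
  assumes lam: "lam > 0" and w: "\<forall>i j. w i j \<ge> 0" and \<delta>: "\<delta> \<ge> 0"
    and bound: "\<And>\<phi>. beckmann_dual_objective E w \<sigma> \<delta> lam (\<alpha> - \<beta>) \<phi> \<le> M"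
  obtains J where "J \<in> beckmann_feasible E \<sigma> \<delta> \<alpha> \<beta>" "beckmann_objective E w lam J \<le> M"
proof -
  define \<epsilon> where "\<epsilon> n = 1 / real (Suc n)" for n
  have \<epsilon>: "\<epsilon> n > 0" for n by (simp add: \<epsilon>_def)
  have "\<exists>\<phi>. \<forall>\<psi>. beckmann_dual_objective E w \<sigma> \<delta> lam (\<alpha> - \<beta>) \<psi> - \<epsilon> n / 2 * (norm \<psi>)\<^sup>2
      \<le> beckmann_dual_objective E w \<sigma> \<delta> lam (\<alpha> - \<beta>) \<phi> - \<epsilon> n / 2 * (norm \<phi>)\<^sup>2" for n
    using regularized_dual_attained[OF lam w \<delta> \<epsilon>] by metis
  then obtain \<phi> where
    \<phi>: "\<And>n \<psi>. beckmann_dual_objective E w \<sigma> \<delta> lam (\<alpha> - \<beta>) \<psi> - \<epsilon> n / 2 * (norm \<psi>)\<^sup>2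
      \<le> beckmann_dual_objective E w \<sigma> \<delta> lam (\<alpha> - \<beta>) (\<phi> n) - \<epsilon> n / 2 * (norm (\<phi> n))\<^sup>2"
    by metis
  define J where "J n = edge_threshold E w lam (incidence_transpose E \<sigma> (\<phi> n))" for n
  have feas: "infnorm (incidence E \<sigma> (J n) - (\<alpha> - \<beta>) + \<epsilon> n *\<^sub>R \<phi> n) \<le> \<delta>" for n
    unfolding J_def by (rule regularized_dual_optimality(1)[OF lam w \<delta> \<phi>])
  have cost: "beckmann_objective E w lam (J n) + \<epsilon> n * (norm (\<phi> n))\<^sup>2 \<le> M" for n
    using regularized_dual_optimality(2)[OF lam w \<delta> \<phi>, of n] bound[of "\<phi> n"]
    unfolding J_def by linarith
  have cost_J: "beckmann_objective E w lam (J n) \<le> M" for n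
    using cost[of n] \<epsilon>[of n] by (smt (verit) mult_nonneg_nonneg zero_le_power2)
  \<comment> \<open>The \<open>\<phi> n\<close> themselves may be unbounded. The cost estimate
    controls \<open>\<epsilon> n * (norm (\<phi> n))\<^sup>2\<close>, and one more factor
    \<open>\<epsilon> n\<close> makes the feasibility error vanish.\<close>
  have "(norm (\<epsilon> n *\<^sub>R \<phi> n))\<^sup>2 \<le> M * \<epsilon> n" for n
  proof -
    have "0 \<le> lam / 2 * (norm (J n))\<^sup>2" using lam by simp
    then have "\<epsilon> n * (norm (\<phi> n))\<^sup>2 \<le> M"
      using cost[of n] beckmann_objective_ge[OF w, of lam "J n" E] by linarith
    from mult_right_mono[OF this less_imp_le[OF \<epsilon>[of n]]] show ?thesis
      by (simp add: power_mult_distrib power2_eq_square mult_ac)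
  qed
  moreover have "(\<lambda>n. M * \<epsilon> n) \<longlonglongrightarrow> 0"
    unfolding \<epsilon>_def using tendsto_mult_right_zero[OF lim_1_over_n[THEN LIMSEQ_Suc], of M] by simp
  ultimately have "(\<lambda>n. (norm (\<epsilon> n *\<^sub>R \<phi> n))\<^sup>2) \<longlonglongrightarrow> 0"
    using tendsto_sandwich[of "\<lambda>_. 0" "\<lambda>n. (norm (\<epsilon> n *\<^sub>R \<phi> n))\<^sup>2" sequentially "\<lambda>n. M * \<epsilon> n" 0]
    by simp
  then have err: "(\<lambda>n. \<epsilon> n *\<^sub>R \<phi> n) \<longlonglongrightarrow> 0"
    by (simp only: power_tendsto_0_iff[OF zero_less_numeral] tendsto_norm_zero_iff)
  \<comment> \<open>The quadratic term of the cost is coercive in \<open>J\<close>, which gives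
    compactness.\<close>
  have "norm (J n) \<le> sqrt (2 * M / lam)" for n
    using cost_J[of n] beckmann_objective_ge[OF w, of lam "J n" E] lam
    by (intro real_le_rsqrt) (simp add: field_simps)
  then have "bounded (range J)" by (auto simp: bounded_iff)
  then obtain L s where s: "strict_mono (s :: nat \<Rightarrow> nat)" and L: "(J \<circ> s) \<longlonglongrightarrow> L"
    using bounded_imp_convergent_subsequence by blast
  show ?thesis
  proof (rule that[of L])
    have "L \<in> edge_space E"
      using closed_sequentially[OF closed_edge_space _ L] by (simp add: J_def edge_threshold_in_edge_space)
    moreover have "infnorm (incidence E \<sigma> L - (\<alpha> - \<beta>)) \<le> \<delta>"
    proof (rule tendsto_upperbound)
      have "(\<lambda>n. incidence E \<sigma> (J (s n))) \<longlonglongrightarrow> incidence E \<sigma> L"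
        using L linear_incidence[of E \<sigma>]
        by (auto simp: o_def linear_conv_bounded_linear intro: bounded_linear.tendsto)
      from tendsto_add[OF tendsto_diff[OF this tendsto_const] LIMSEQ_subseq_LIMSEQ[OF err s]]
      have "(\<lambda>n. incidence E \<sigma> (J (s n)) - (\<alpha> - \<beta>) + \<epsilon> (s n) *\<^sub>R \<phi> (s n))
          \<longlonglongrightarrow> incidence E \<sigma> L - (\<alpha> - \<beta>)"
        by (simp add: o_def)
      then show "(\<lambda>n. infnorm (incidence E \<sigma> (J (s n)) - (\<alpha> - \<beta>) + \<epsilon> (s n) *\<^sub>R \<phi> (s n)))
          \<longlonglongrightarrow> infnorm (incidence E \<sigma> L - (\<alpha> - \<beta>))"
        by (rule tendsto_infnorm)
    qed (use feas in auto)
    ultimately show "L \<in> beckmann_feasible E \<sigma> \<delta> \<alpha> \<beta>" by (simp add: beckmann_feasible_def)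
    show "beckmann_objective E w lam L \<le> M"
    proof (rule tendsto_upperbound)
      show "(\<lambda>n. beckmann_objective E w lam (J (s n))) \<longlonglongrightarrow> beckmann_objective E w lam L"
        using continuous_on_tendsto_compose[OF continuous_beckmann_objective L] by (simp add: o_def)
    qed (use cost_J in auto)
  qed
qed

section \<open>Strong duality and the primal minimiser\<close>

lemma beckmann_weak_duality:
  assumes lam: "lam > 0" and w: "\<forall>i j. w i j \<ge> 0"
    and J: "J \<in> beckmann_feasible E \<sigma> \<delta> \<alpha> \<beta>"
  shows "beckmann_dual_objective E w \<sigma> \<delta> lam (\<alpha> - \<beta>) \<phi> \<le> beckmann_objective E w lam J"
  using beckmann_gap[OF assms, where \<phi> = \<phi>] lam
  by (smt (verit) divide_nonneg_nonneg mult_nonneg_nonneg zero_le_power2)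

lemma beckmann_strong_duality:
  assumes lam: "lam > 0" and w: "\<forall>i j. w i j \<ge> 0" and \<delta>: "\<delta> \<ge> 0"
  shows "beckmann_value E w \<sigma> \<delta> lam \<alpha> \<beta>
    = (SUP \<phi>. ereal (beckmann_dual_objective E w \<sigma> \<delta> lam (\<alpha> - \<beta>) \<phi>))" (is "_ = ?D")
proof (rule antisym)
  show "?D \<le> beckmann_value E w \<sigma> \<delta> lam \<alpha> \<beta>"
    unfolding beckmann_value_def
    by (intro SUP_least INF_greatest) (simp add: beckmann_weak_duality[OF lam w])
  show "beckmann_value E w \<sigma> \<delta> lam \<alpha> \<beta> \<le> ?D"
  \<comment> \<open>Testing against real upper bounds \<open>M\<close> of the dual value also
    settles an infinite dual value, where no such \<open>M\<close> exists; this is the case of an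
    infeasible primal problem.\<close>
  proof (rule ereal_le_real)
    fix M assume "?D \<le> ereal M"
    then have "\<And>\<phi>. beckmann_dual_objective E w \<sigma> \<delta> lam (\<alpha> - \<beta>) \<phi> \<le> M"
      by (simp add: SUP_le_iff)
    then obtain J where "J \<in> beckmann_feasible E \<sigma> \<delta> \<alpha> \<beta>" "beckmann_objective E w lam J \<le> M"
      using beckmann_feasible_of_bounded_dual[OF lam w \<delta>] by blast
    then show "beckmann_value E w \<sigma> \<delta> lam \<alpha> \<beta> \<le> ereal M"
      unfolding beckmann_value_def by (intro INF_lower2[of J]) simp_all
  qed
qed

text \<open>A feasible flow costing at most the dual maximum has no gap, so the quadratic remainder
  in \<open>beckmann_gap\<close> forces it to be the threshold. Such a flow exists by compactness,
  so feasibility of the threshold is inherited rather than checked directly.\<close>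

lemma beckmann_minimizer_iff:
  assumes lam: "lam > 0" and w: "\<forall>i j. w i j \<ge> 0" and \<delta>: "\<delta> \<ge> 0"
    and opt: "\<And>\<phi>. beckmann_dual_objective E w \<sigma> \<delta> lam (\<alpha> - \<beta>) \<phi>
      \<le> beckmann_dual_objective E w \<sigma> \<delta> lam (\<alpha> - \<beta>) \<phi>\<^sub>0"
  shows "is_arg_min (beckmann_objective E w lam) (\<lambda>J. J \<in> beckmann_feasible E \<sigma> \<delta> \<alpha> \<beta>) J
    \<longleftrightarrow> J = edge_threshold E w lam (incidence_transpose E \<sigma> \<phi>\<^sub>0)" (is "_ \<longleftrightarrow> J = ?J")
proof -
  let ?g = "beckmann_dual_objective E w \<sigma> \<delta> lam (\<alpha> - \<beta>) \<phi>\<^sub>0"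
  have uniq: "K = ?J" if K: "K \<in> beckmann_feasible E \<sigma> \<delta> \<alpha> \<beta>" "beckmann_objective E w lam K \<le> ?g" for K
  proof -
    have "lam / 2 * (norm (K - ?J))\<^sup>2 \<le> 0"
      using beckmann_gap[OF lam w K(1), where \<phi> = \<phi>\<^sub>0] K(2) by linarith
    then show ?thesis using lam by (simp add: mult_le_0_iff)
  qed
  have J: "?J \<in> beckmann_feasible E \<sigma> \<delta> \<alpha> \<beta>" "beckmann_objective E w lam ?J \<le> ?g"
    using beckmann_feasible_of_bounded_dual[OF lam w \<delta> opt] uniq by metis+
  show ?thesis
  proof
    assume "is_arg_min (beckmann_objective E w lam) (\<lambda>J. J \<in> beckmann_feasible E \<sigma> \<delta> \<alpha> \<beta>) J"
    then show "J = ?J" using J by (intro uniq) (force simp: is_arg_min_linorder)+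
  next
    assume "J = ?J"
    then show "is_arg_min (beckmann_objective E w lam) (\<lambda>J. J \<in> beckmann_feasible E \<sigma> \<delta> \<alpha> \<beta>) J"
      using J beckmann_weak_duality[OF lam w, where \<phi> = \<phi>\<^sub>0]
      by (auto simp: is_arg_min_linorder intro: order_trans)
  qed
qed

lemma eq_edge_threshold_iff:
  fixes J :: "('d::finite, 'n::{finite,linorder}) edge_fun"
  shows "J = edge_threshold E w lam Y \<longleftrightarrow> J \<in> edge_space E \<and>
    (\<forall>e\<in>oriented_edges E. J $ e = soft_threshold lam (w (fst e) (snd e)) (Y $ e))"
  by (auto simp: edge_threshold_def edge_space_def vec_eq_iff[of J])

theorem theorem3p3:
  fixes E :: "'n::{finite,linorder} set set"
    and w :: "'n \<Rightarrow> 'n \<Rightarrow> real"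
    and \<sigma> :: "'n \<times> 'n \<Rightarrow> real^'d^'d"
    and \<alpha> \<beta> c :: "('d, 'n) vertex_fun"
    and lam \<delta> :: real
  assumes "connection_graph E w \<sigma>"
    and "lam > 0"
    and "\<delta> \<ge> 0"
    and "c = \<alpha> - \<beta>"
  shows
    "(\<forall>\<phi>. (SUP (\<xi>\<^sub>1, \<xi>\<^sub>2) \<in> {(\<xi>\<^sub>1, \<xi>\<^sub>2). 0 \<le> \<xi>\<^sub>1 \<and> 0 \<le> \<xi>\<^sub>2 \<and> \<phi> = \<xi>\<^sub>2 - \<xi>\<^sub>1}.
              lagrange_dual_function E w \<sigma> \<delta> lam c \<xi>\<^sub>1 \<xi>\<^sub>2)
          = ereal (beckmann_dual_objective E w \<sigma> \<delta> lam c \<phi>))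
     \<and> (SUP (\<xi>\<^sub>1, \<xi>\<^sub>2) \<in> {(\<xi>\<^sub>1, \<xi>\<^sub>2). 0 \<le> \<xi>\<^sub>1 \<and> 0 \<le> \<xi>\<^sub>2}.
            lagrange_dual_function E w \<sigma> \<delta> lam c \<xi>\<^sub>1 \<xi>\<^sub>2)
        = (SUP \<phi>. ereal (beckmann_dual_objective E w \<sigma> \<delta> lam c \<phi>))
     \<and> 0 \<le> beckmann_value E w \<sigma> \<delta> lam \<alpha> \<beta>
     \<and> beckmann_value E w \<sigma> \<delta> lam \<alpha> \<beta>
        = (SUP \<phi>. ereal (beckmann_dual_objective E w \<sigma> \<delta> lam c \<phi>))
     \<and> (\<forall>\<phi>\<^sub>0. ereal (beckmann_dual_objective E w \<sigma> \<delta> lam c \<phi>\<^sub>0)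
               = (SUP \<phi>. ereal (beckmann_dual_objective E w \<sigma> \<delta> lam c \<phi>)) \<longrightarrow>
          (\<forall>J. is_arg_min (beckmann_objective E w lam)
                  (\<lambda>J. J \<in> beckmann_feasible E \<sigma> \<delta> \<alpha> \<beta>) J \<longleftrightarrow>
               J \<in> edge_space E \<and>
               (\<forall>e\<in>oriented_edges E.
                  J $ e =
                    (if incidence_transpose E \<sigma> \<phi>\<^sub>0 $ e = 0 then 0
                     else (max ((norm (incidence_transpose E \<sigma> \<phi>\<^sub>0 $ e) - w (fst e) (snd e)) / lam) 0
                           / norm (incidence_transpose E \<sigma> \<phi>\<^sub>0 $ e))
                          *\<^sub>R (incidence_transpose E \<sigma> \<phi>\<^sub>0 $ e)))))"
proof -
  have w: "\<forall>i j. w i j \<ge> 0"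
    using connection_graph.weight_nonneg[OF assms(1)] by blast
  note lam = assms(2) and \<delta> = assms(3) and c = assms(4)
  let ?L = "lagrange_dual_function E w \<sigma> \<delta> lam c"
  let ?g = "beckmann_dual_objective E w \<sigma> \<delta> lam c"
  have dual: "(SUP (\<xi>\<^sub>1, \<xi>\<^sub>2) \<in> {(\<xi>\<^sub>1, \<xi>\<^sub>2). 0 \<le> \<xi>\<^sub>1 \<and> 0 \<le> \<xi>\<^sub>2 \<and> \<phi> = \<xi>\<^sub>2 - \<xi>\<^sub>1}. ?L \<xi>\<^sub>1 \<xi>\<^sub>2)
      = ereal (?g \<phi>)" for \<phi>
    by (rule SUP_lagrange_dual_function[OF lam w \<delta>])
  \<comment> \<open>Splitting the multiplier cone by the value of the difference turns the joint
    supremum into an iterated one, whose inner supremum is \<open>dual\<close>.\<close>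
  have "{(\<xi>\<^sub>1, \<xi>\<^sub>2). 0 \<le> \<xi>\<^sub>1 \<and> 0 \<le> \<xi>\<^sub>2} =
      (\<Union>\<phi>. {(\<xi>\<^sub>1, \<xi>\<^sub>2). 0 \<le> \<xi>\<^sub>1 \<and> 0 \<le> \<xi>\<^sub>2 \<and> \<phi> = \<xi>\<^sub>2 - (\<xi>\<^sub>1 :: ('d, 'n) vertex_fun)})"
    by auto
  then have "(SUP (\<xi>\<^sub>1, \<xi>\<^sub>2) \<in> {(\<xi>\<^sub>1, \<xi>\<^sub>2). 0 \<le> \<xi>\<^sub>1 \<and> 0 \<le> \<xi>\<^sub>2}. ?L \<xi>\<^sub>1 \<xi>\<^sub>2) = (SUP \<phi>. ereal (?g \<phi>))"
    by (simp only: SUP_UNION dual)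
  moreover have "0 \<le> beckmann_objective E w lam J" for J :: "('d, 'n) edge_fun"
    using w lam by (simp add: beckmann_objective_def sum_nonneg)
  then have "0 \<le> beckmann_value E w \<sigma> \<delta> lam \<alpha> \<beta>"
    unfolding beckmann_value_def by (intro INF_greatest) simp
  moreover have "beckmann_value E w \<sigma> \<delta> lam \<alpha> \<beta> = (SUP \<phi>. ereal (?g \<phi>))"
    unfolding c by (rule beckmann_strong_duality[OF lam w \<delta>])
  moreover have "is_arg_min (beckmann_objective E w lam) (\<lambda>J. J \<in> beckmann_feasible E \<sigma> \<delta> \<alpha> \<beta>) J
      \<longleftrightarrow> J = edge_threshold E w lam (incidence_transpose E \<sigma> \<phi>\<^sub>0)"
    if "ereal (?g \<phi>\<^sub>0) = (SUP \<phi>. ereal (?g \<phi>))" for \<phi>\<^sub>0 J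
  proof (rule beckmann_minimizer_iff[OF lam w \<delta>])
    fix \<phi>
    have "ereal (?g \<phi>) \<le> ereal (?g \<phi>\<^sub>0)" unfolding that by (rule SUP_upper) simp
    then show "beckmann_dual_objective E w \<sigma> \<delta> lam (\<alpha> - \<beta>) \<phi>
        \<le> beckmann_dual_objective E w \<sigma> \<delta> lam (\<alpha> - \<beta>) \<phi>\<^sub>0"
      by (simp add: c)
  qed
  ultimately show ?thesis
    using dual by (simp only: eq_edge_threshold_iff soft_threshold_def) blast
qed

end
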